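(* Let $\mathcal{G}$ be a time-varying weighted digraph on $N$ nodes which is strongly connected and weight-balanced at all times and whose adjacency matrix $(\mathsf{a}_{ij}(t))$ is uniformly bounded and piecewise constant in time. For each $i\in\{1,\dots,N\}$ let $f^i:\mathbb{R}^d\to\mathbb{R}$ be differentiable and $m^i$-strongly convex ($m^i>0$), with $\nabla f^i$ being $M^i$-Lipschitz on $\mathbb{R}^d$ ($M^i>0$). Put $\underline{m}=\min_i m^i$ and $\overline{M}=\max_i M^i$. Let $\mathsf{x}^\star\in\mathbb{R}^d$ be the minimizer of $f=\sum_{i=1}^N f^i$. Let $\mathcal{P}$ be the index set of all possible realizations of $\mathcal{G}$, let $\mathsf{L}_p$ be the Laplacian of realization $p\in\mathcal{P}$, and let $(\hat\lambda_2)_{\min}=\min_{p\in\mathcal{P}}\hat\lambda_2(\mathsf{L}_p)$, where $\hat\lambda_2(\mathsf{L}_p)$ is the smallest nonzero eigenvalue of $\tfrac12(\mathsf{L}_p+\mathsf{L}_p^\top)$. Given $\alpha>0$, let $\beta,\phi>0$ satisfy $\phi+1>4\overline{M}$ and $$\alpha^2(\phi+1)\underline{m}+9\beta(\hat\lambda_2)_{\min}\phi\alpha-4\alpha^2\big(\overline{M}\,\underline{m}+(\phi+1)^2\big)>0 .$$ Consider the system, for $i\in\{1,\dots,N\}$, $$\dot v^i=\alpha\beta\sum_{j=1}^N\mathsf{a}_{ij}(t)(x^i-x^j),\qquad \dot x^i=-\alpha\nabla f^i(x^i)-\beta\sum_{j=1}^N\mathsf{a}_{ij}(t)(x^i-x^j)-v^i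 .$$ Then, for every initial condition $x^i(0),v^i(0)\in\mathbb{R}^d$, $i\in\{1,\dots,N\}$, with $\sum_{i=1}^N v^i(0)=0$, and for each $i\in\{1,\dots,N\}$, $x^i(t)\to\mathsf{x}^\star$ exponentially fast as $t\to\infty$.
   Context: A weighted digraph on nodes $\{1,\dots,N\}$ ($N\ge 2$) has a nonnegative adjacency matrix $\mathsf{A}=(\mathsf{a}_{ij})$ with $\mathsf{a}_{ij}>0$ iff $(i,j)$ is an edge and $\mathsf{a}_{ij}=0$ otherwise. It is strongly connected if there is a directed path between every ordered pair of nodes. It is weight-balanced if $\sum_j\mathsf{a}_{ij}=\sum_j\mathsf{a}_{ji}$ for every $i$. The Laplacian is $\mathsf{L}=\mathrm{Diag}(\mathsf{d}^1_{\rm out},\dots,\mathsf{d}^N_{\rm out})-\mathsf{A}$ with $\mathsf{d}^i_{\rm out}=\sum_j\mathsf{a}_{ij}$. For a strongly connected and weight-balanced digraph, $\tfrac12(\mathsf{L}+\mathsf{L}^\top)$ is positive semidefinite with $0$ as a simple eigenvalue. The minimum defining $(\hat\lambda_2)_{\min}$ is understood to be attained, so it is positive. Piecewise constant means finitely many switches on every bounded time interval. A differentiable $f$ is $m$-strongly convex if $(z-x)^\top(\nabla f(z)-\nabla f(x))\ge m\|z-x\|^2$ for all $x,z$. A map $g$ is $M$-Lipschitz if $\|g(x)-g(y)\|\le M\|x-y\|$ for all $x,y$. Norms are Euclidean. Exponentially fast convergence $x^i(t)\to\mathsf{x}^\star$ means there are constants $C\ge0$, $r>0$ with $\|x^i(t)-\mathsf{x}^\star\|\le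 Ce^{-rt}$ for all $t\ge0$. *)

theory Defs
  imports "HOL-Analysis.Analysis"
begin

(* A weighted digraph on the finite node type 'n is given by its adjacency matrix;
   its edges are the positions of the positive entries. *)

definition is_adjacency :: "real^'n^'n \<Rightarrow> bool" where
  "is_adjacency A \<longleftrightarrow> (\<forall>i j. 0 \<le> A $ i $ j)"

definition edges :: "real^'n^'n \<Rightarrow> ('n \<times> 'n) set" where
  "edges A = {(i, j). 0 < A $ i $ j}"

definition strongly_connected :: "real^'n^'n \<Rightarrow> bool" where
  "strongly_connected A \<longleftrightarrow> (\<forall>i j. (i, j) \<in> (edges A)\<^sup>*)"

definition weight_balanced :: "real^'n^'n \<Rightarrow> bool" where
  "weight_balanced A \<longleftrightarrow> (\<forall>i. (\<Sum>j\<in>UNIV. A $ i $ j) = (\<Sum>j\<in>UNIV. A $ j $ i))"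

definition out_degree :: "real^'n^'n \<Rightarrow> 'n \<Rightarrow> real" where
  "out_degree A i = (\<Sum>j\<in>UNIV. A $ i $ j)"

definition laplacian :: "real^'n^'n \<Rightarrow> real^'n^'n" where
  "laplacian A = (\<chi> i j. if i = j then out_degree A i else 0) - A"

definition eigenvalue :: "real^'n^'n \<Rightarrow> real \<Rightarrow> bool" where
  "eigenvalue B k \<longleftrightarrow> (\<exists>v. v \<noteq> 0 \<and> B *v v = k *\<^sub>R v)"

definition sym_part :: "real^'n^'n \<Rightarrow> real^'n^'n" where
  "sym_part B = (1/2) *\<^sub>R (B + transpose B)"

(* The matrix sym_part B is real symmetric, so its eigenvalues are real and finitely many, and Min
   is meaningful as soon as one of them is nonzero. This is the case for the Laplacian of a strongly
   connected weight-balanced digraph with at least two nodes. *)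
definition lambda2_hat :: "real^'n^'n \<Rightarrow> real" where
  "lambda2_hat B = Min {k. eigenvalue (sym_part B) k \<and> k \<noteq> 0}"

(* Only times t \<ge> 0 matter: t = 0 counts as a switching time iff the value at 0 differs from the
   values immediately after 0. No one-sided continuity is imposed at switching times. *)
definition switching_times :: "(real \<Rightarrow> 'a) \<Rightarrow> real set" where
  "switching_times A = {t. 0 \<le> t \<and> \<not> (\<exists>e>0. \<forall>s\<ge>0. \<bar>s - t\<bar> < e \<longrightarrow> A s = A t)}"

definition piecewise_constant :: "(real \<Rightarrow> 'a) \<Rightarrow> bool" where
  "piecewise_constant A \<longleftrightarrow> (\<forall>T. finite (switching_times A \<inter> {0..T}))"

definition gradient :: "('a::real_inner \<Rightarrow> real) \<Rightarrow> 'a \<Rightarrow> 'a" where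
  "gradient f x = (THE g. GDERIV f x :> g)"

definition strongly_convex :: "real \<Rightarrow> ('a::real_inner \<Rightarrow> real) \<Rightarrow> bool" where
  "strongly_convex m f \<longleftrightarrow>
     (\<forall>x. f differentiable (at x)) \<and>
     (\<forall>x z. (z - x) \<bullet> (gradient f z - gradient f x) \<ge> m * (norm (z - x))\<^sup>2)"

(* Since the right-hand side jumps with A, a solution on [0, \<infinity>) is continuous and satisfies the
   differential equations at every time that is not a switching time of A. If A is
   piecewise constant and the gradients are continuous, these are exactly the Caratheodory solutions. *)
definition solution ::
  "real \<Rightarrow> real \<Rightarrow> (real \<Rightarrow> real^'n^'n) \<Rightarrow> ('n \<Rightarrow> real^'d \<Rightarrow> real) \<Rightarrow>
   ('n \<Rightarrow> real \<Rightarrow> real^'d) \<Rightarrow> ('n \<Rightarrow> real \<Rightarrow> real^'d) \<Rightarrow> bool" where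
  "solution \<alpha> \<beta> A f x v \<longleftrightarrow>
     (\<forall>i. continuous_on {0..} (x i) \<and> continuous_on {0..} (v i)) \<and>
     (\<forall>t\<ge>0. t \<notin> switching_times A \<longrightarrow> (\<forall>i.
        (v i has_vector_derivative
           (\<alpha> * \<beta>) *\<^sub>R (\<Sum>j\<in>UNIV. A t $ i $ j *\<^sub>R (x i t - x j t)))
           (at t within {0..}) \<and>
        (x i has_vector_derivative
           - \<alpha> *\<^sub>R gradient (f i) (x i t)
           - \<beta> *\<^sub>R (\<Sum>j\<in>UNIV. A t $ i $ j *\<^sub>R (x i t - x j t))
           - v i t)
           (at t within {0..})))"

definition converges_exponentially :: "(real \<Rightarrow> 'a::real_normed_vector) \<Rightarrow> 'a \<Rightarrow> bool" where
  "converges_exponentially y l \<longleftrightarrow>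
     (\<exists>C\<ge>0. \<exists>r>0. \<forall>t\<ge>0. norm (y t - l) \<le> C * exp (- r * t))"

end

(* Let y = x - xstar, h = grad f(x) - grad f(xstar) and w = v + alpha grad f(xstar), agent by agent.
   Weight balance and stationarity of xstar give sum w = 0 for all times. In the combination
   u = alpha y + w the Laplacian cancels: u' = - alpha^2 h - alpha w. Hence
   V = phi alpha^2 / 2 |y|^2 + 1/2 |u|^2 is a Lyapunov function common to all graphs: V' <= - r V with
   r > 0 follows from cocoercivity |h|^2 <= M (y . h), from the spectral gap of the symmetrized
   Laplacian and from the Young inequalities
     |K (y - c) . w| <= 4/9 K^2 |y - c|^2 + 9/16 |w|^2  and  |alpha w . h| <= 4 alpha^2 |h|^2 + 1/16 |w|^2,
   where K = (phi + 1) alpha and c is the average of y. *)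

theory Submission
  imports Defs
begin

section \<open>Gradients, convexity inequalities and cocoercivity\<close>

lemma GDERIV_unique:
  fixes f :: "'a::real_inner \<Rightarrow> real"
  assumes "GDERIV f x :> g" and "GDERIV f x :> g'"
  shows "g = g'"
proof -
  have "(\<lambda>h. h \<bullet> g) = (\<lambda>h. h \<bullet> g')"
    using has_derivative_unique assms unfolding gderiv_def by blast
  then have "(g - g') \<bullet> (g - g') = 0"
    by (metis inner_diff_right diff_self)
  then show ?thesis
    by simp
qed

text \<open>The Riesz vector of the derivative \<open>D\<close> has the coordinates
  \<open>D b\<close>, so a gradient exists; its uniqueness then evaluates the definite description
  in \<open>gradient\<close>.\<close>

lemma GDERIV_gradient:
  fixes f :: "'a::euclidean_space \<Rightarrow> real"
  assumes "f differentiable (at x)"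
  shows "GDERIV f x :> gradient f x"
proof -
  obtain D where D: "(f has_derivative D) (at x)"
    using assms by (auto simp: differentiable_def)
  interpret D: linear D
    using D by (rule has_derivative_linear)
  have "D h = h \<bullet> (\<Sum>b\<in>Basis. D b *\<^sub>R b)" for h
  proof -
    have "D h = D (\<Sum>b\<in>Basis. (h \<bullet> b) *\<^sub>R b)"
      by (simp add: euclidean_representation)
    also have "\<dots> = h \<bullet> (\<Sum>b\<in>Basis. D b *\<^sub>R b)"
      by (simp add: D.sum D.scaleR inner_sum_right mult.commute)
    finally show ?thesis .
  qed
  then have "D = (\<lambda>h. h \<bullet> (\<Sum>b\<in>Basis. D b *\<^sub>R b))"
    by (rule ext)
  then have g: "GDERIV f x :> (\<Sum>b\<in>Basis. D b *\<^sub>R b)"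
    using D unfolding gderiv_def by metis
  show ?thesis
    unfolding gradient_def by (rule theI, rule g) (rule GDERIV_unique[OF _ g])
qed

lemma DERIV_along_line:
  fixes F :: "'a::real_inner \<Rightarrow> real"
  assumes "\<And>z. GDERIV F z :> G z"
  shows "((\<lambda>t. F (x + t *\<^sub>R d)) has_field_derivative (G (x + t *\<^sub>R d) \<bullet> d)) (at t)"
proof -
  have "((\<lambda>t. x + t *\<^sub>R d) has_derivative (\<lambda>h. h *\<^sub>R d)) (at t)"
    by (auto intro!: derivative_eq_intros)
  moreover have "(F has_derivative (\<lambda>h. h \<bullet> G (x + t *\<^sub>R d))) (at (x + t *\<^sub>R d))"
    using assms by (simp add: gderiv_def)
  ultimately have "((\<lambda>t. F (x + t *\<^sub>R d)) has_derivative (\<lambda>h. (h *\<^sub>R d) \<bullet> G (x + t *\<^sub>R d))) (at t)"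
    using has_derivative_compose by fastforce
  then show ?thesis
    by (simp add: has_field_derivative_def inner_commute mult_commute_abs)
qed

text \<open>The gap between \<open>F\<close> and its tangent at \<open>x\<close> is followed along
  the segment from \<open>x\<close> to \<open>z\<close>. Its slope at \<open>t > 0\<close> is
  nonnegative because monotonicity between \<open>x + t *\<^sub>R d\<close> and \<open>x\<close> may
  be divided by \<open>t\<close>; at \<open>t = 0\<close> the slope is zero.\<close>

lemma first_order_lower_bound:
  fixes F :: "'a::real_inner \<Rightarrow> real"
  assumes G: "\<And>z. GDERIV F z :> G z"
    and mono: "\<And>x z. 0 \<le> (z - x) \<bullet> (G z - G x)"
  shows "F x + G x \<bullet> (z - x) \<le> F z"
proof -
  define d where "d = z - x"
  define K where "K t = F (x + t *\<^sub>R d) - t * (G x \<bullet> d)" for t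
  have "K 0 \<le> K 1"
  proof (rule DERIV_nonneg_imp_nondecreasing[where f = K])
    fix t :: real assume t: "0 \<le> t" "t \<le> 1"
    have "(K has_field_derivative (G (x + t *\<^sub>R d) \<bullet> d - G x \<bullet> d)) (at t)"
      unfolding K_def by (auto intro!: derivative_eq_intros DERIV_along_line G)
    moreover have "0 \<le> G (x + t *\<^sub>R d) \<bullet> d - G x \<bullet> d"
    proof (cases "t = 0")
      case False
      have "0 \<le> t * ((G (x + t *\<^sub>R d) - G x) \<bullet> d)"
        using mono[of "x + t *\<^sub>R d" x] by (simp add: inner_commute)
      then show ?thesis
        using False t by (simp add: zero_le_mult_iff inner_diff_left)
    qed simp
    ultimately show "\<exists>y. (K has_field_derivative y) (at t) \<and> 0 \<le> y"
      by blast
  qed simp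
  then show ?thesis
    by (simp add: K_def d_def)
qed

text \<open>Along the segment the slope of \<open>F\<close> exceeds its initial value by at most
  \<open>M * t * (norm d)\<^sup>2\<close>; the quadratic term subtracted in \<open>K\<close> is the
  integral of this excess.\<close>

lemma descent_bound:
  fixes F :: "'a::real_inner \<Rightarrow> real"
  assumes G: "\<And>z. GDERIV F z :> G z"
    and lip: "\<And>x z. norm (G z - G x) \<le> M * norm (z - x)"
  shows "F z \<le> F x + G x \<bullet> (z - x) + M / 2 * (norm (z - x))\<^sup>2"
proof -
  define d where "d = z - x"
  define K where "K t = F (x + t *\<^sub>R d) - t * (G x \<bullet> d) - M / 2 * (norm d)\<^sup>2 * t\<^sup>2" for t
  have "K 1 \<le> K 0"
  proof (rule DERIV_nonpos_imp_nonincreasing[where f = K])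
    fix t :: real assume t: "0 \<le> t" "t \<le> 1"
    have "(K has_field_derivative (G (x + t *\<^sub>R d) \<bullet> d - G x \<bullet> d - M * (norm d)\<^sup>2 * t)) (at t)"
      unfolding K_def by (auto intro!: derivative_eq_intros DERIV_along_line G)
    moreover have "(G (x + t *\<^sub>R d) - G x) \<bullet> d \<le> M * (t * norm d) * norm d"
    proof -
      have "(G (x + t *\<^sub>R d) - G x) \<bullet> d \<le> norm (G (x + t *\<^sub>R d) - G x) * norm d"
        by (rule norm_cauchy_schwarz)
      also have "\<dots> \<le> M * (t * norm d) * norm d"
        using lip[of "x + t *\<^sub>R d" x] t by (intro mult_right_mono) auto
      finally show ?thesis .
    qed
    then have "G (x + t *\<^sub>R d) \<bullet> d - G x \<bullet> d - M * (norm d)\<^sup>2 * t \<le> 0"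
      by (simp add: inner_diff_left power2_eq_square mult_ac)
    ultimately show "\<exists>y. (K has_field_derivative y) (at t) \<and> y \<le> 0"
      by blast
  qed simp
  then show ?thesis
    by (simp add: K_def d_def)
qed

text \<open>Baillon--Haddad: the first-order lower bound is applied at the point reached from \<open>z\<close> by
  one gradient step of length \<open>1 / M\<close> for \<open>F - G x \<bullet> _\<close>.\<close>

lemma cocoercive:
  fixes F :: "'a::real_inner \<Rightarrow> real"
  assumes G: "\<And>z. GDERIV F z :> G z"
    and mono: "\<And>x z. 0 \<le> (z - x) \<bullet> (G z - G x)"
    and lip: "\<And>x z. norm (G z - G x) \<le> M * norm (z - x)"
    and "0 < M"
  shows "(norm (G z - G x))\<^sup>2 \<le> M * ((z - x) \<bullet> (G z - G x))"
proof -
  have half: "F x + G x \<bullet> (z - x) + (norm (G z - G x))\<^sup>2 / (2 * M) \<le> F z" for x z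
  proof -
    define p where "p = G z - G x"
    define u where "u = z - (1 / M) *\<^sub>R p"
    have "F x + G x \<bullet> (u - x) \<le> F u"
      by (rule first_order_lower_bound[OF G mono])
    moreover have "F u \<le> F z + G z \<bullet> (u - z) + M / 2 * (norm (u - z))\<^sup>2"
      by (rule descent_bound[OF G lip])
    moreover have "M / 2 * (norm (u - z))\<^sup>2 = (norm p)\<^sup>2 / (2 * M)"
      using \<open>0 < M\<close> by (simp add: u_def power2_eq_square field_simps)
    moreover have "G z \<bullet> (u - z) = - (G z \<bullet> p) / M"
      by (simp add: u_def)
    moreover have "G x \<bullet> (u - x) = G x \<bullet> (z - x) - (G x \<bullet> p) / M"
      by (simp add: u_def inner_diff_right)
    moreover have "(G z \<bullet> p) / M - (G x \<bullet> p) / M = (norm p)\<^sup>2 / M"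
      by (simp add: p_def power2_norm_eq_inner inner_diff_left flip: diff_divide_distrib)
    moreover have "(norm p)\<^sup>2 / M = 2 * ((norm p)\<^sup>2 / (2 * M))"
      by simp
    ultimately show ?thesis
      unfolding p_def[symmetric] by linarith
  qed
  \<comment> \<open>Adding the inequality to its mirror image under the exchange of \<open>x\<close>
    and \<open>z\<close> cancels the function values.\<close>
  have "(norm (G z - G x))\<^sup>2 / (2 * M) + (norm (G z - G x))\<^sup>2 / (2 * M) \<le> (z - x) \<bullet> (G z - G x)"
    using half[of x z] half[of z x]
    by (simp add: norm_minus_commute inner_diff_right inner_diff_left inner_commute)
  then show ?thesis
    using \<open>0 < M\<close> by (simp add: field_simps)
qed

section \<open>Monotonicity of continuous functions off a finite set\<close>

lemma nonincreasing_off_finite_set: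
  fixes g :: "real \<Rightarrow> real"
  assumes "finite S" and "a \<le> b" and cont: "continuous_on {a..b} g"
    and deriv: "\<And>t. t \<in> {a<..<b} - S \<Longrightarrow> \<exists>D\<le>0. (g has_vector_derivative D) (at t)"
  shows "g b \<le> g a"
proof -
  obtain D where D: "\<And>t. t \<in> {a<..<b} - S \<Longrightarrow> D t \<le> 0 \<and> (g has_vector_derivative D t) (at t)"
    using deriv by metis
  \<comment> \<open>The default 0 at exceptional points and end points keeps the integrand
    nonpositive on all of \<open>{a..b}\<close>; the fundamental theorem ignores its values
    there.\<close>
  define D' where "D' t = (if t \<in> {a<..<b} - S then D t else 0)" for t
  have "(D' has_integral (g b - g a)) {a..b}"
    using assms(1,2) cont D
    by (intro fundamental_theorem_of_calculus_interior_strong) (auto simp: D'_def)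
  moreover have "((\<lambda>t. 0 :: real) has_integral 0) {a..b}"
    by simp
  ultimately have "g b - g a \<le> 0"
    by (rule has_integral_le) (use D in \<open>auto simp: D'_def\<close>)
  then show ?thesis
    by simp
qed

section \<open>Eigenvalues of symmetric maps\<close>

text \<open>The quadratic form attains its minimum on the compact unit sphere of \<open>U\<close>.
  The first variation at a minimizer vanishes in all directions of \<open>U\<close>, and invariance
  puts the residual of the eigenvalue equation among these directions.\<close>

lemma rayleigh_minimum_on_subspace:
  fixes T :: "'a::euclidean_space \<Rightarrow> 'a"
  assumes "linear T" and self_adjoint: "\<And>x y. T x \<bullet> y = x \<bullet> T y"
    and U: "subspace U" "U \<noteq> {0}" and invariant: "T ` U \<subseteq> U"
  obtains q k where "q \<in> U" "q \<noteq> 0" "T q = k *\<^sub>R q"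
    "\<And>p. p \<in> U \<Longrightarrow> k * (norm p)\<^sup>2 \<le> p \<bullet> T p"
proof -
  interpret T: linear T by fact
  define S where "S = U \<inter> sphere 0 1"
  have "compact S"
    unfolding S_def using closed_subspace[OF U(1)] by (simp add: closed_Int_compact)
  have normalized: "(1 / norm p) *\<^sub>R p \<in> S" if "p \<in> U" "p \<noteq> 0" for p
    using that U(1) by (simp add: S_def subspace_scale)
  obtain p where "p \<in> U" "p \<noteq> 0"
    using U subspace_0 by blast
  then have "S \<noteq> {}"
    using normalized by blast
  have "continuous_on S (\<lambda>p. p \<bullet> T p)"
    by (intro continuous_intros linear_continuous_on linear_conv_bounded_linear[THEN iffD1] \<open>linear T\<close>)
  from continuous_attains_inf[OF \<open>compact S\<close> \<open>S \<noteq> {}\<close> this]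
  obtain q where q: "q \<in> S" and min: "\<And>p. p \<in> S \<Longrightarrow> q \<bullet> T q \<le> p \<bullet> T p"
    by blast
  define k where "k = q \<bullet> T q"
  have bound: "k * (norm p)\<^sup>2 \<le> p \<bullet> T p" if "p \<in> U" for p
  proof (cases "p = 0")
    case False
    have "k \<le> (p \<bullet> T p) / (norm p)\<^sup>2"
      using min[OF normalized[OF that False]]
      by (simp add: k_def T.scaleR power2_eq_square divide_simps)
    then show ?thesis
      using False by (simp add: pos_le_divide_eq)
  qed simp
  define r where "r = T q - k *\<^sub>R q"
  have "q \<in> U" and "norm q = 1"
    using q by (auto simp: S_def)
  then have "r \<in> U"
    unfolding r_def using U(1) invariant by (intro subspace_diff subspace_scale) auto
  have "q \<bullet> q = 1"
    using \<open>norm q = 1\<close> by (simp add: norm_eq_1)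
  have qr: "q \<bullet> T r = r \<bullet> r + k * (q \<bullet> r)"
  proof -
    have "q \<bullet> T r = T q \<bullet> r" by (simp add: self_adjoint)
    also have "T q = r + k *\<^sub>R q" by (simp add: r_def)
    finally show ?thesis by (simp add: inner_add_left)
  qed
  have rq: "r \<bullet> T q = r \<bullet> r + k * (q \<bullet> r)"
    using qr by (metis inner_commute self_adjoint)
  define R where "R = r \<bullet> T r - k * (r \<bullet> r)"
  \<comment> \<open>The minimum property is tested at \<open>q + s *\<^sub>R r\<close>. All terms
    with \<open>q \<bullet> r\<close> cancel, so the first-order coefficient is just
    \<open>2 * (r \<bullet> r)\<close>.\<close>
  have "0 \<le> 2 * s * (r \<bullet> r) + s\<^sup>2 * R" for s
  proof -
    have "q + s *\<^sub>R r \<in> U"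
      using \<open>q \<in> U\<close> \<open>r \<in> U\<close> U(1) by (simp add: subspace_add subspace_scale)
    from bound[OF this] have le: "k * ((q + s *\<^sub>R r) \<bullet> (q + s *\<^sub>R r)) \<le> (q + s *\<^sub>R r) \<bullet> T (q + s *\<^sub>R r)"
      by (simp add: power2_norm_eq_inner)
    have "(q + s *\<^sub>R r) \<bullet> T (q + s *\<^sub>R r) = k + 2 * s * (r \<bullet> r + k * (q \<bullet> r)) + s\<^sup>2 * (r \<bullet> T r)"
      by (simp add: T.add T.scaleR inner_add_left inner_add_right qr rq k_def power2_eq_square) algebra
    moreover have "(q + s *\<^sub>R r) \<bullet> (q + s *\<^sub>R r) = 1 + 2 * s * (q \<bullet> r) + s\<^sup>2 * (r \<bullet> r)"
      using \<open>q \<bullet> q = 1\<close>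
      by (simp add: inner_add_left inner_add_right power2_eq_square inner_commute[of r q] algebra_simps)
    ultimately have "k * (1 + 2 * s * (q \<bullet> r) + s\<^sup>2 * (r \<bullet> r))
        \<le> k + 2 * s * (r \<bullet> r + k * (q \<bullet> r)) + s\<^sup>2 * (r \<bullet> T r)"
      using le by metis
    then show ?thesis
      by (simp add: R_def algebra_simps)
  qed note quad = this
  have "r \<bullet> r = 0"
  proof (rule ccontr)
    assume "r \<bullet> r \<noteq> 0"
    then have pos: "r \<bullet> r > 0" by simp
    \<comment> \<open>A negative step short enough that the quadratic term cancels at most half of
      the linear one; the added 1 keeps the denominator positive when \<open>R = 0\<close>.\<close>
    define s where "s = - (r \<bullet> r) / (\<bar>R\<bar> + 1)"
    have "s\<^sup>2 * R \<le> s\<^sup>2 * (\<bar>R\<bar> + 1)"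
      by (intro mult_left_mono) auto
    also have "\<dots> = - s * (r \<bullet> r)"
      by (simp add: s_def power2_eq_square divide_simps)
    finally have "0 \<le> s * (r \<bullet> r)"
      using quad[of s] by simp
    moreover have "s < 0"
      unfolding s_def using pos by (intro divide_neg_pos) linarith+
    ultimately show False
      using pos by (simp add: zero_le_mult_iff)
  qed
  then have "T q = k *\<^sub>R q"
    by (simp add: r_def)
  moreover have "q \<noteq> 0"
    using \<open>norm q = 1\<close> by auto
  ultimately show thesis
    using that \<open>q \<in> U\<close> bound by blast
qed


lemma sym_part_mult_vector: "sym_part B *v q = (1/2) *\<^sub>R (B *v q + q v* B)"
  by (simp add: sym_part_def scaleR_matrix_vector_assoc[symmetric] matrix_vector_mult_add_rdistrib)

lemma inner_vector_matrix_mult: "p \<bullet> ((q :: real^'n) v* B) = q \<bullet> (B *v p)"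
  by (metis dot_lmul_matrix inner_commute)

lemma sym_part_self_adjoint: "(sym_part B *v p) \<bullet> q = p \<bullet> (sym_part B *v q)"
  by (simp add: sym_part_mult_vector inner_add_left inner_add_right inner_vector_matrix_mult
      dot_lmul_matrix) (simp add: inner_commute)

lemma inner_sym_part: "q \<bullet> (sym_part B *v q) = q \<bullet> (B *v q)"
  by (simp add: sym_part_mult_vector inner_add_right inner_vector_matrix_mult)

text \<open>Eigenvectors chosen for distinct eigenvalues of a symmetric matrix are orthogonal, and a
  pairwise orthogonal set in finite dimension is finite. This allows \<open>Min\<close> in
  \<open>lambda2_hat\<close> to be used as a lower bound.\<close>

lemma finite_eigenvalues_sym_part: "finite {k. eigenvalue (sym_part B) k}"
proof -
  let ?K = "{k. eigenvalue (sym_part B) k}"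
  have "\<forall>k\<in>?K. \<exists>v. v \<noteq> 0 \<and> sym_part B *v v = k *\<^sub>R v"
    by (simp add: eigenvalue_def)
  from bchoice[OF this]
  obtain e where e: "\<And>k. k \<in> ?K \<Longrightarrow> e k \<noteq> 0 \<and> sym_part B *v e k = k *\<^sub>R e k"
    by blast
  have orth: "e k \<bullet> e l = 0" if "k \<in> ?K" "l \<in> ?K" "k \<noteq> l" for k l
  proof -
    have "k * (e k \<bullet> e l) = l * (e k \<bullet> e l)"
      using sym_part_self_adjoint[of B "e k" "e l"] e that by simp
    then show ?thesis
      using that by simp
  qed
  have "inj_on e ?K"
    using orth e by (metis inj_onI inner_eq_zero_iff)
  moreover have "finite (e ` ?K)"
    using orth by (intro pairwise_orthogonal_imp_finite) (auto simp: pairwise_def orthogonal_def)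
  ultimately show ?thesis
    using finite_imageD by blast
qed

section \<open>Laplacians and Dirichlet forms of weight-balanced digraphs\<close>

lemma laplacian_mult_vector:
  "(laplacian A *v q) $ i = (\<Sum>j\<in>UNIV. A $ i $ j * (q $ i - q $ j))"
proof -
  have "(laplacian A *v q) $ i
      = (\<Sum>j\<in>UNIV. (if i = j then out_degree A i * q $ j else 0) - A $ i $ j * q $ j)"
    by (auto simp: laplacian_def matrix_vector_mult_def left_diff_distrib intro!: sum.cong)
  also have "\<dots> = (\<Sum>j\<in>UNIV. A $ i $ j * (q $ i - q $ j))"
    by (simp add: sum_subtractf out_degree_def sum_distrib_right right_diff_distrib)
  finally show ?thesis .
qed

text \<open>Expanding the squares gives one sum weighted by rows and one weighted by columns of
  \<open>A\<close>. Weight balance makes both equal to \<open>X\<close>, so the result is twice the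
  left-hand side.\<close>

lemma balanced_dirichlet_form:
  fixes y :: "'n::finite \<Rightarrow> 'a::real_inner"
  assumes "weight_balanced A"
  shows "(\<Sum>i\<in>UNIV. y i \<bullet> (\<Sum>j\<in>UNIV. A $ i $ j *\<^sub>R (y i - y j)))
    = (\<Sum>i\<in>UNIV. \<Sum>j\<in>UNIV. A $ i $ j * (norm (y i - y j))\<^sup>2) / 2"
proof -
  define X where "X = (\<Sum>i\<in>UNIV. \<Sum>j\<in>UNIV. A $ i $ j * (y i \<bullet> y i))"
  define Z where "Z = (\<Sum>i\<in>UNIV. \<Sum>j\<in>UNIV. A $ i $ j * (y i \<bullet> y j))"
  have "(\<Sum>i\<in>UNIV. \<Sum>j\<in>UNIV. A $ i $ j * (y j \<bullet> y j))
      = (\<Sum>j\<in>UNIV. (\<Sum>i\<in>UNIV. A $ i $ j) * (y j \<bullet> y j))"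
    unfolding sum_distrib_right by (rule sum.swap)
  also have "\<dots> = X"
    using assms by (simp add: X_def weight_balanced_def flip: sum_distrib_right)
  finally have swap: "(\<Sum>i\<in>UNIV. \<Sum>j\<in>UNIV. A $ i $ j * (y j \<bullet> y j)) = X" .
  have "(\<Sum>i\<in>UNIV. \<Sum>j\<in>UNIV. A $ i $ j * (norm (y i - y j))\<^sup>2)
      = (\<Sum>i\<in>UNIV. \<Sum>j\<in>UNIV. A $ i $ j * (y i \<bullet> y i) + A $ i $ j * (y j \<bullet> y j)
          - 2 * (A $ i $ j * (y i \<bullet> y j)))"
    by (intro sum.cong refl)
      (simp add: power2_norm_eq_inner inner_diff_left inner_diff_right inner_commute algebra_simps)
  also have "\<dots> = X + X - 2 * Z"
    by (simp add: sum.distrib sum_subtractf swap sum_distrib_left[symmetric] Z_def X_def)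
  finally show ?thesis
    by (simp add: X_def Z_def inner_sum_right inner_diff_right right_diff_distrib sum_subtractf)
qed

lemma balanced_laplacian_form:
  fixes q :: "real^'n"
  assumes "weight_balanced A"
  shows "q \<bullet> (laplacian A *v q) = (\<Sum>i\<in>UNIV. \<Sum>j\<in>UNIV. A $ i $ j * (q $ i - q $ j)\<^sup>2) / 2"
  using balanced_dirichlet_form[OF assms, of "\<lambda>i. q $ i"]
  by (simp add: inner_vec_def laplacian_mult_vector)

text \<open>The all-ones vector lies in the left kernel of the Laplacian. This serves the invariance
  of the zero-sum subspace as well as a conservation law of the dynamics.\<close>

lemma balanced_flow_sum:
  fixes y :: "'n::finite \<Rightarrow> 'a::real_vector"
  assumes "weight_balanced A"
  shows "(\<Sum>i\<in>UNIV. \<Sum>j\<in>UNIV. A $ i $ j *\<^sub>R (y i - y j)) = 0"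
proof -
  have "(\<Sum>i\<in>UNIV. \<Sum>j\<in>UNIV. A $ i $ j *\<^sub>R y j) = (\<Sum>j\<in>UNIV. (\<Sum>i\<in>UNIV. A $ i $ j) *\<^sub>R y j)"
    unfolding scaleR_sum_left by (rule sum.swap)
  also have "\<dots> = (\<Sum>i\<in>UNIV. \<Sum>j\<in>UNIV. A $ i $ j *\<^sub>R y i)"
    using assms by (simp add: weight_balanced_def flip: scaleR_sum_left)
  finally show ?thesis
    by (simp add: scaleR_diff_right sum_subtractf)
qed

text \<open>A vanishing sum of nonnegative terms forces equal values across each edge, hence along
  each directed path.\<close>

lemma dirichlet_form_zero_imp_constant:
  fixes q :: "real^'n"
  assumes "is_adjacency A" and "strongly_connected A"
    and zero: "(\<Sum>i\<in>UNIV. \<Sum>j\<in>UNIV. A $ i $ j * (q $ i - q $ j)\<^sup>2) = 0"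
  shows "q $ i = q $ j"
proof -
  have nonneg: "0 \<le> A $ i $ j * (q $ i - q $ j)\<^sup>2" for i j
    using assms(1) by (simp add: is_adjacency_def)
  have "A $ i $ j * (q $ i - q $ j)\<^sup>2 = 0" for i j
    using zero nonneg by (simp add: sum_nonneg_eq_0_iff sum_nonneg)
  then have edge: "q $ i = q $ j" if "(i, j) \<in> edges A" for i j
    using that by (force simp: edges_def)
  have "(i, j) \<in> (edges A)\<^sup>*"
    using assms(2) by (simp add: strongly_connected_def)
  then show ?thesis
    by induction (use edge in auto)
qed

text \<open>The Rayleigh minimum \<open>k\<close> over zero-sum vectors is an eigenvalue of the
  symmetrized Laplacian. Strong connectivity excludes \<open>k = 0\<close>, so \<open>k\<close>
  competes in the minimum that defines \<open>lambda2_hat\<close>.\<close>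

lemma lambda2_hat_laplacian_bound:
  fixes q :: "real^'n"
  assumes "is_adjacency A" "strongly_connected A" and bal: "weight_balanced A"
    and card: "CARD('n) \<ge> 2" and q: "(\<Sum>i\<in>UNIV. q $ i) = 0"
  shows "lambda2_hat (laplacian A) * (norm q)\<^sup>2 \<le> q \<bullet> (laplacian A *v q)"
proof -
  let ?S = "sym_part (laplacian A)"
  define U where "U = {p :: real^'n. (\<Sum>i\<in>UNIV. p $ i) = 0}"
  have "subspace U"
    by (auto simp: U_def subspace_def sum.distrib sum_distrib_left[symmetric])
  moreover have "U \<noteq> {0}"
  proof -
    \<comment> \<open>Two distinct nodes yield a nonzero vector with zero sum.\<close>
    obtain a b :: 'n where "a \<noteq> b"
      using card by (metis card_2_iff' card_le_Suc0_iff_eq finite UNIV_I not_less_eq_eq numeral_2_eq_2)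
    then have "axis a 1 - axis b 1 \<noteq> (0 :: real^'n)"
      by (simp add: axis_eq_axis)
    moreover have "axis a 1 - axis b 1 \<in> U"
      by (simp add: U_def axis_def sum_subtractf)
    ultimately show ?thesis
      by blast
  qed
  moreover have "(*v) ?S ` U \<subseteq> U"
  proof -
    \<comment> \<open>Constants are annihilated from the right by the row sums and from the left by
      weight balance. Self-adjointness then makes the range of the symmetrized Laplacian orthogonal
      to constants, that is, contained in \<open>U\<close>.\<close>
    have "?S *v 1 = 0"
    proof -
      have "laplacian A *v 1 = 0"
        by (simp add: vec_eq_iff laplacian_mult_vector)
      moreover have "1 v* laplacian A = 0"
      proof -
        have "(1 v* laplacian A) \<bullet> p = 0" for p
        proof -
          have "(1 v* laplacian A) \<bullet> p = (\<Sum>i\<in>UNIV. (laplacian A *v p) $ i)"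
            unfolding dot_lmul_matrix by (simp add: inner_vec_def)
          also have "\<dots> = 0"
            using balanced_flow_sum[OF bal, of "\<lambda>i. p $ i"] by (simp add: laplacian_mult_vector)
          finally show ?thesis .
        qed
        then show ?thesis
          by (metis inner_eq_zero_iff)
      qed
      ultimately show ?thesis
        by (simp add: sym_part_mult_vector)
    qed
    then have "1 \<bullet> (?S *v p) = 0" for p
      by (metis inner_zero_left sym_part_self_adjoint)
    then show ?thesis
      by (auto simp: U_def inner_vec_def)
  qed
  ultimately obtain r k where r: "r \<in> U" "r \<noteq> 0" and eig: "?S *v r = k *\<^sub>R r"
    and min: "\<And>p. p \<in> U \<Longrightarrow> k * (norm p)\<^sup>2 \<le> p \<bullet> (?S *v p)"
    using rayleigh_minimum_on_subspace[OF matrix_vector_mul_linear sym_part_self_adjoint] by metis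
  have "k \<noteq> 0"
  proof
    assume "k = 0"
    then have "r \<bullet> (laplacian A *v r) = 0"
      using eig by (simp flip: inner_sym_part)
    then have const: "r $ i = r $ j" for i j
      using assms dirichlet_form_zero_imp_constant by (simp add: balanced_laplacian_form)
    have "r $ i = 0" for i
    proof -
      have "(\<Sum>j\<in>UNIV. r $ j) = (\<Sum>j\<in>(UNIV :: 'n set). r $ i)"
        using const by (intro sum.cong) auto
      then show ?thesis
        using r(1) by (simp add: U_def)
    qed
    then show False
      using r(2) by (simp add: vec_eq_iff)
  qed
  then have "lambda2_hat (laplacian A) \<le> k"
    unfolding lambda2_hat_def using r(2) eig
    by (intro Min_le finite_subset[OF _ finite_eigenvalues_sym_part[of "laplacian A"]])
      (auto simp: eigenvalue_def)
  then have "lambda2_hat (laplacian A) * (norm q)\<^sup>2 \<le> k * (norm q)\<^sup>2"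
    by (intro mult_right_mono) auto
  also have "\<dots> \<le> q \<bullet> (laplacian A *v q)"
    using min[of q] q by (simp add: U_def inner_sym_part)
  finally show ?thesis .
qed

lemma power2_norm_vec: "(norm (z :: real^'d))\<^sup>2 = (\<Sum>k\<in>UNIV. (z $ k)\<^sup>2)"
  unfolding power2_norm_eq_inner inner_vec_def by (simp add: power2_eq_square)

text \<open>The scalar bound is applied to each coordinate of the deviations \<open>y i - c\<close>
  and summed; differences between nodes do not see the shift by \<open>c\<close>.\<close>

lemma lambda2_hat_dirichlet_bound:
  fixes y :: "'n::finite \<Rightarrow> real^'d"
  assumes "is_adjacency A" "strongly_connected A" and bal: "weight_balanced A"
    and card: "CARD('n) \<ge> 2"
    and c: "(\<Sum>i\<in>UNIV. y i - c) = 0"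
  shows "lambda2_hat (laplacian A) * (\<Sum>i\<in>UNIV. (norm (y i - c))\<^sup>2)
    \<le> (\<Sum>i\<in>UNIV. y i \<bullet> (\<Sum>j\<in>UNIV. A $ i $ j *\<^sub>R (y i - y j)))"
proof -
  define q where "q k = (\<chi> i. (y i - c) $ k)" for k
  have "(\<Sum>i\<in>UNIV. q k $ i) = 0" for k
    using arg_cong[OF c, of "\<lambda>z. z $ k"] by (simp add: q_def)
  then have "lambda2_hat (laplacian A) * (norm (q k))\<^sup>2 \<le> q k \<bullet> (laplacian A *v q k)" for k
    using assms by (intro lambda2_hat_laplacian_bound)
  then have "(\<Sum>k\<in>UNIV. lambda2_hat (laplacian A) * (norm (q k))\<^sup>2)
      \<le> (\<Sum>k\<in>UNIV. (\<Sum>i\<in>UNIV. \<Sum>j\<in>UNIV. A $ i $ j * (q k $ i - q k $ j)\<^sup>2) / 2)"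
    by (intro sum_mono) (simp flip: balanced_laplacian_form[OF bal])
  moreover have "(\<Sum>k\<in>UNIV. lambda2_hat (laplacian A) * (norm (q k))\<^sup>2)
      = lambda2_hat (laplacian A) * (\<Sum>i\<in>UNIV. (norm (y i - c))\<^sup>2)"
    unfolding sum_distrib_left[symmetric] power2_norm_vec
    by (subst sum.swap) (simp add: q_def)
  moreover have "(\<Sum>k\<in>UNIV. (\<Sum>i\<in>UNIV. \<Sum>j\<in>UNIV. A $ i $ j * (q k $ i - q k $ j)\<^sup>2) / 2)
      = (\<Sum>i\<in>UNIV. \<Sum>j\<in>UNIV. A $ i $ j * (norm (y i - y j))\<^sup>2) / 2"
  proof -
    have "(\<Sum>k\<in>UNIV. \<Sum>i\<in>UNIV. \<Sum>j\<in>UNIV. A $ i $ j * (q k $ i - q k $ j)\<^sup>2)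
        = (\<Sum>i\<in>UNIV. \<Sum>j\<in>UNIV. \<Sum>k\<in>UNIV. A $ i $ j * (q k $ i - q k $ j)\<^sup>2)"
      by (subst sum.swap, intro sum.cong refl, subst sum.swap, rule refl)
    also have "\<dots> = (\<Sum>i\<in>UNIV. \<Sum>j\<in>UNIV. A $ i $ j * (norm (y i - y j))\<^sup>2)"
      by (simp add: q_def power2_norm_vec sum_distrib_left)
    finally show ?thesis
      by (simp flip: sum_divide_distrib)
  qed
  ultimately show ?thesis
    by (simp add: balanced_dirichlet_form[OF bal])
qed

section \<open>The dissipation estimate\<close>

text \<open>Pythagoras: the deviations sum to zero, so they are orthogonal in total to the constant
  \<open>c\<close>.\<close>

lemma sum_power2_norm_deviation:
  fixes y :: "'n::finite \<Rightarrow> 'a::real_inner"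
  assumes "(\<Sum>i\<in>UNIV. y i - c) = 0"
  shows "(\<Sum>i\<in>UNIV. (norm (y i - c))\<^sup>2) \<le> (\<Sum>i\<in>UNIV. (norm (y i))\<^sup>2)"
proof -
  have "(\<Sum>i\<in>UNIV. (norm (y i))\<^sup>2)
      = (\<Sum>i\<in>UNIV. (norm (y i - c))\<^sup>2 + 2 * ((y i - c) \<bullet> c) + (norm c)\<^sup>2)"
    by (intro sum.cong refl)
      (simp add: power2_norm_eq_inner inner_diff_left inner_diff_right inner_commute algebra_simps)
  also have "\<dots> = (\<Sum>i\<in>UNIV. (norm (y i - c))\<^sup>2) + 2 * ((\<Sum>i\<in>UNIV. y i - c) \<bullet> c)
      + (\<Sum>i\<in>(UNIV :: 'n set). (norm c)\<^sup>2)"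
    by (simp only: sum.distrib sum_distrib_left[symmetric] inner_sum_left)
  finally show ?thesis
    using assms by simp
qed

text \<open>The cross term \<open>y \<bullet> w\<close> only sees the disagreement \<open>y - c\<close> because \<open>w\<close> has zero mean, so it
  can be paid for by the Laplacian; the term \<open>w \<bullet> h\<close> is paid for by cocoercivity.\<close>

lemma lyapunov_dissipation:
  fixes y w h :: "'n::finite \<Rightarrow> 'a::real_inner" and c :: 'a
    and \<alpha> \<beta> \<phi> lam m M Q :: real
  assumes pos: "\<alpha> > 0" "\<beta> > 0" "\<phi> > 0" "m > 0"
    and w: "(\<Sum>i\<in>UNIV. w i) = 0" and c: "(\<Sum>i\<in>UNIV. y i - c) = 0"
    and strong: "\<And>i. m * (norm (y i))\<^sup>2 \<le> y i \<bullet> h i"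
    and coco: "\<And>i. (norm (h i))\<^sup>2 \<le> M * (y i \<bullet> h i)"
    and Q: "lam * (\<Sum>i\<in>UNIV. (norm (y i - c))\<^sup>2) \<le> Q"
    and phi: "\<phi> + 1 > 4 * M"
    and cond: "\<alpha>\<^sup>2 * (\<phi> + 1) * m + 9 * \<beta> * lam * \<phi> * \<alpha> - 4 * \<alpha>\<^sup>2 * (M * m + (\<phi> + 1)\<^sup>2) > 0"
  shows "8 / 9 * (\<phi> + 1 - 4 * M) * m * \<alpha>\<^sup>2 * (\<Sum>i\<in>UNIV. (norm (y i))\<^sup>2)
      + 3 / 8 * (\<Sum>i\<in>UNIV. (norm (w i))\<^sup>2)
    \<le> (\<phi> + 1) * \<alpha>\<^sup>2 * (\<Sum>i\<in>UNIV. y i \<bullet> h i) + \<phi> * \<alpha> * \<beta> * Q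
      + (\<phi> + 1) * \<alpha> * (\<Sum>i\<in>UNIV. y i \<bullet> w i) + \<alpha> * (\<Sum>i\<in>UNIV. w i \<bullet> h i)
      + (\<Sum>i\<in>UNIV. (norm (w i))\<^sup>2)"
proof -
  define K where "K = (\<phi> + 1) * \<alpha>"
  define G where "G = (\<phi> + 1 - 4 * M) * m * \<alpha>\<^sup>2"
  define Y where "Y = (\<Sum>i\<in>UNIV. (norm (y i))\<^sup>2)"
  define P where "P = (\<Sum>i\<in>UNIV. (norm (y i - c))\<^sup>2)"
  define W where "W = (\<Sum>i\<in>UNIV. (norm (w i))\<^sup>2)"
  define H where "H = (\<Sum>i\<in>UNIV. (norm (h i))\<^sup>2)"
  define X where "X = (\<Sum>i\<in>UNIV. y i \<bullet> h i)"
  define YW where "YW = (\<Sum>i\<in>UNIV. y i \<bullet> w i)"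
  define WH where "WH = (\<Sum>i\<in>UNIV. w i \<bullet> h i)"
  have "m * Y \<le> X"
    unfolding Y_def X_def sum_distrib_left by (intro sum_mono strong)
  have "H \<le> M * X"
    unfolding H_def X_def sum_distrib_left by (intro sum_mono coco)
  have "P \<le> Y" and "0 \<le> P"
    unfolding P_def Y_def using sum_power2_norm_deviation[OF c] by (auto intro: sum_nonneg)
  have "YW = (\<Sum>i\<in>UNIV. (y i - c) \<bullet> w i)"
    using w by (simp add: YW_def inner_diff_left sum_subtractf flip: inner_sum_right)
  \<comment> \<open>The square has coefficients 2/3 and 3/4 since 2 * 2/3 * 3/4 = 1. Together with
    the 1/16 spent on the other cross term, 5/8 of \<open>W\<close> is used and 3/8 remains.\<close>
  then have "4 / 9 * K\<^sup>2 * P + 9 / 16 * W + K * YW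
      = (\<Sum>i\<in>UNIV. 4 / 9 * K\<^sup>2 * (norm (y i - c))\<^sup>2 + 9 / 16 * (norm (w i))\<^sup>2 + K * ((y i - c) \<bullet> w i))"
    by (simp only: P_def W_def sum.distrib sum_distrib_left)
  also have "\<dots> = (\<Sum>i\<in>UNIV. (norm ((2 / 3 * K) *\<^sub>R (y i - c) + (3 / 4) *\<^sub>R w i))\<^sup>2)"
  proof (intro sum.cong refl)
    show "4 / 9 * K\<^sup>2 * (norm (y i - c))\<^sup>2 + 9 / 16 * (norm (w i))\<^sup>2 + K * ((y i - c) \<bullet> w i)
        = (norm ((2 / 3 * K) *\<^sub>R (y i - c) + (3 / 4) *\<^sub>R w i))\<^sup>2" for i
      unfolding power2_norm_eq_inner inner_add_left inner_add_right inner_scaleR_left inner_scaleR_right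
      by (simp add: inner_commute power2_eq_square algebra_simps)
  qed
  also have "\<dots> \<ge> 0"
    by (intro sum_nonneg) simp
  finally have young1: "0 \<le> 4 / 9 * K\<^sup>2 * P + 9 / 16 * W + K * YW" .
  \<comment> \<open>The weight 4 on \<open>H\<close> is the one that meets the 4 in the hypothesis
    \<open>phi\<close>.\<close>
  have "4 * \<alpha>\<^sup>2 * H + W / 16 + \<alpha> * WH
      = (\<Sum>i\<in>UNIV. 4 * \<alpha>\<^sup>2 * (norm (h i))\<^sup>2 + (norm (w i))\<^sup>2 / 16 + \<alpha> * (w i \<bullet> h i))"
    by (simp only: H_def W_def WH_def sum.distrib sum_distrib_left sum_divide_distrib)
  also have "\<dots> = (\<Sum>i\<in>UNIV. (norm ((2 * \<alpha>) *\<^sub>R h i + (1 / 4) *\<^sub>R w i))\<^sup>2)"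
  proof (intro sum.cong refl)
    show "4 * \<alpha>\<^sup>2 * (norm (h i))\<^sup>2 + (norm (w i))\<^sup>2 / 16 + \<alpha> * (w i \<bullet> h i)
        = (norm ((2 * \<alpha>) *\<^sub>R h i + (1 / 4) *\<^sub>R w i))\<^sup>2" for i
      unfolding power2_norm_eq_inner inner_add_left inner_add_right inner_scaleR_left inner_scaleR_right
      by (simp add: inner_commute power2_eq_square algebra_simps)
  qed
  also have "\<dots> \<ge> 0"
    by (intro sum_nonneg) simp
  finally have young2: "0 \<le> 4 * \<alpha>\<^sup>2 * H + W / 16 + \<alpha> * WH" .
  have "0 < G"
    using pos phi by (simp add: G_def)
  \<comment> \<open>The factor \<phi> + 1 of \<open>X\<close> is split: the part
    \<open>4 * M\<close> pays for \<open>H\<close> by cocoercivity, the positive rest yields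
    \<open>G * Y\<close> by strong convexity.\<close>
  have "(\<phi> + 1 - 4 * M) * \<alpha>\<^sup>2 * (m * Y) \<le> (\<phi> + 1 - 4 * M) * \<alpha>\<^sup>2 * X"
    using phi \<open>m * Y \<le> X\<close> by (intro mult_left_mono) auto
  moreover have "4 * \<alpha>\<^sup>2 * H \<le> 4 * \<alpha>\<^sup>2 * (M * X)"
    using \<open>H \<le> M * X\<close> by (intro mult_left_mono) auto
  ultimately have gradient_terms: "G * Y + 4 * \<alpha>\<^sup>2 * H \<le> (\<phi> + 1) * \<alpha>\<^sup>2 * X"
    by (simp add: G_def algebra_simps)
  have K2: "K\<^sup>2 = (\<phi> + 1)\<^sup>2 * \<alpha>\<^sup>2"
    by (simp only: K_def power_mult_distrib)
  \<comment> \<open>The first factor is exactly the left-hand side of \<open>cond\<close>. After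
    division by 9, the Laplacian term and one ninth of \<open>G * Y\<close> cover the disagreement
    term, leaving 8/9 of \<open>G * Y\<close>.\<close>
  have "0 \<le> (G + 9 * \<beta> * lam * \<phi> * \<alpha> - 4 * K\<^sup>2) * P"
    using cond \<open>0 \<le> P\<close>
    by (intro mult_nonneg_nonneg) (auto simp: G_def K2 algebra_simps)
  moreover have "G * P \<le> G * Y"
    using \<open>P \<le> Y\<close> \<open>0 < G\<close> by (intro mult_left_mono) auto
  moreover have "\<phi> * \<alpha> * \<beta> * (lam * P) \<le> \<phi> * \<alpha> * \<beta> * Q"
    using Q pos unfolding P_def by (intro mult_left_mono) auto
  ultimately have "4 / 9 * K\<^sup>2 * P \<le> \<phi> * \<alpha> * \<beta> * Q + G * Y / 9"
    by (simp add: algebra_simps)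
  with young1 young2 gradient_terms
  have "8 / 9 * (G * Y) + 3 / 8 * W \<le> (\<phi> + 1) * \<alpha>\<^sup>2 * X + \<phi> * \<alpha> * \<beta> * Q + K * YW + \<alpha> * WH + W"
    by linarith
  then show ?thesis
    unfolding X_def[symmetric] Y_def[symmetric] W_def[symmetric] YW_def[symmetric] WH_def[symmetric]
    by (simp only: G_def K_def mult.assoc)
qed

section \<open>Conservation and decay across switching times\<close>

lemma constant_off_switching_times:
  fixes g :: "real \<Rightarrow> 'a::banach"
  assumes "\<And>T. finite (S \<inter> {0..T})" and "continuous_on {0..} g"
    and "\<And>t. 0 < t \<Longrightarrow> t \<notin> S \<Longrightarrow> (g has_vector_derivative 0) (at t)" and "0 \<le> t"
  shows "g t = g 0"
proof -
  have "((\<lambda>_. 0) has_integral (g t - g 0)) {0..t}"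
    using assms
    by (intro fundamental_theorem_of_calculus_interior_strong[of "S \<inter> {0..t}"])
      (auto intro: continuous_on_subset)
  then show ?thesis
    by simp
qed

text \<open>Gronwall's argument: the integrating factor \<open>exp (r * s)\<close> turns the
  differential inequality into monotonicity, which persists through switching times because
  \<open>V\<close> is continuous.\<close>

lemma exponential_decay_off_switching_times:
  fixes V :: "real \<Rightarrow> real"
  assumes "\<And>T. finite (S \<inter> {0..T})" and "continuous_on {0..} V"
    and deriv: "\<And>t. 0 < t \<Longrightarrow> t \<notin> S \<Longrightarrow> \<exists>D\<le>- r * V t. (V has_vector_derivative D) (at t)"
    and "0 \<le> t"
  shows "V t \<le> V 0 * exp (- r * t)"
proof -
  define g where "g s = exp (r * s) * V s" for s
  have "g t \<le> g 0"
  proof (rule nonincreasing_off_finite_set[where g = g])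
    show "finite (S \<inter> {0..t})" by fact
    show "continuous_on {0..t} g"
      unfolding g_def using continuous_on_subset[OF assms(2)]
      by (intro continuous_intros) auto
    fix s assume "s \<in> {0<..<t} - S \<inter> {0..t}"
    then obtain D where "D \<le> - r * V s" and D: "(V has_vector_derivative D) (at s)"
      using deriv[of s] by auto
    have "(g has_vector_derivative (exp (r * s) * (D + r * V s))) (at s)"
      using D unfolding g_def has_real_derivative_iff_has_vector_derivative[symmetric]
      by (auto intro!: derivative_eq_intros simp: algebra_simps)
    moreover have "exp (r * s) * (D + r * V s) \<le> 0"
      using \<open>D \<le> - r * V s\<close> by (intro mult_nonneg_nonpos) auto
    ultimately show "\<exists>D\<le>0. (g has_vector_derivative D) (at s)"
      by blast
  qed fact
  then have "exp (r * t) * V t \<le> V 0"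
    by (simp add: g_def)
  then show ?thesis
    by (simp add: exp_minus field_simps)
qed

section \<open>Exponential convergence of the switched dynamics\<close>

theorem proposition4:
  fixes A :: "real \<Rightarrow> real^'n^'n"
    and P :: "'p set" and adj :: "'p \<Rightarrow> real^'n^'n"
    and f :: "'n \<Rightarrow> real^'d \<Rightarrow> real"
    and m M :: "'n \<Rightarrow> real"
    and xstar :: "real^'d"
    and lam2min \<alpha> \<beta> \<phi> :: real
    and x v :: "'n \<Rightarrow> real \<Rightarrow> real^'d"
  assumes "CARD('n) \<ge> 2"
    and "\<forall>p\<in>P. is_adjacency (adj p) \<and> strongly_connected (adj p) \<and> weight_balanced (adj p)"
    and "\<forall>t\<ge>0. \<exists>p\<in>P. A t = adj p"
    and "bounded (A ` {0..})"
    and "piecewise_constant A"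
    and "\<forall>i. m i > 0 \<and> strongly_convex (m i) (f i)"
    and "\<forall>i. M i > 0 \<and> (M i)-lipschitz_on UNIV (gradient (f i))"
    and "is_arg_min (\<lambda>z. \<Sum>i\<in>UNIV. f i z) (\<lambda>_. True) xstar"
    and "\<exists>p\<in>P. lam2min = lambda2_hat (laplacian (adj p))"
    and "\<forall>p\<in>P. lam2min \<le> lambda2_hat (laplacian (adj p))"
    and "\<alpha> > 0" and "\<beta> > 0" and "\<phi> > 0"
    and "\<phi> + 1 > 4 * Max (range M)"
    and "\<alpha>\<^sup>2 * (\<phi> + 1) * Min (range m) + 9 * \<beta> * lam2min * \<phi> * \<alpha>
         - 4 * \<alpha>\<^sup>2 * (Max (range M) * Min (range m) + (\<phi> + 1)\<^sup>2) > 0"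
    and "solution \<alpha> \<beta> A f x v"
    and "(\<Sum>i\<in>UNIV. v i 0) = 0"
  shows "\<forall>i. converges_exponentially (x i) xstar"
proof
  fix i0 :: 'n
  let ?S = "switching_times A"
  define mm where "mm = Min (range m)"
  define MM where "MM = Max (range M)"
  define g where "g i z = gradient (f i) z" for i z
  define flow where "flow i t = (\<Sum>j\<in>UNIV. A t $ i $ j *\<^sub>R (x i t - x j t))" for i t
  \<comment> \<open>Coordinates centred at the equilibrium, where \<open>x i\<close> is
    \<open>xstar\<close> and \<open>v i\<close> is
    \<open>- \<alpha> *\<^sub>R g i xstar\<close>.\<close>
  define y where "y i t = x i t - xstar" for i t
  define h where "h i t = g i (x i t) - g i xstar" for i t
  define w where "w i t = v i t + \<alpha> *\<^sub>R g i xstar" for i t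
  note pos = \<open>\<alpha> > 0\<close> \<open>\<beta> > 0\<close> \<open>\<phi> > 0\<close>
  have mm_le: "mm \<le> m i" and MM_ge: "M i \<le> MM" for i
    by (simp_all add: mm_def MM_def)
  have "mm \<in> range m"
    unfolding mm_def by (rule Min_in) auto
  then have "0 < mm"
    using assms(6) by auto
  have phi: "\<phi> + 1 > 4 * MM"
    using assms(14) by (simp add: MM_def)
  have G: "GDERIV (f i) z :> g i z" for i z
    unfolding g_def using assms(6) by (auto simp: strongly_convex_def intro!: GDERIV_gradient)
  have mono: "m i * (norm (b - a))\<^sup>2 \<le> (b - a) \<bullet> (g i b - g i a)" for i a b
    unfolding g_def using assms(6) by (auto simp: strongly_convex_def)
  have strong: "mm * (norm (y i t))\<^sup>2 \<le> y i t \<bullet> h i t" for i t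
  proof -
    have "mm * (norm (y i t))\<^sup>2 \<le> m i * (norm (y i t))\<^sup>2"
      by (intro mult_right_mono mm_le) simp
    also have "\<dots> \<le> y i t \<bullet> h i t"
      unfolding y_def h_def by (rule mono)
    finally show ?thesis .
  qed
  have coco: "(norm (h i t))\<^sup>2 \<le> MM * (y i t \<bullet> h i t)" for i t
  proof -
    have "(norm (h i t))\<^sup>2 \<le> M i * (y i t \<bullet> h i t)"
      unfolding y_def h_def
    proof (rule cocoercive[OF G])
      show "0 \<le> (b - a) \<bullet> (g i b - g i a)" for a b
        using mono[of i b a] assms(6) by (meson less_imp_le mult_nonneg_nonneg order_trans zero_le_power2)
      show "norm (g i b - g i a) \<le> M i * norm (b - a)" for a b
        using assms(7) by (auto simp: g_def lipschitz_on_def dist_norm)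
      show "0 < M i"
        using assms(7) by blast
    qed
    also have "\<dots> \<le> MM * (y i t \<bullet> h i t)"
    proof (intro mult_right_mono MM_ge)
      have "0 \<le> mm * (norm (y i t))\<^sup>2"
        using \<open>0 < mm\<close> by simp
      then show "0 \<le> y i t \<bullet> h i t"
        using strong[of i t] by linarith
    qed
    finally show ?thesis .
  qed
  \<comment> \<open>The individual gradients at \<open>xstar\<close> may be nonzero; the vanishing
    of their sum makes the shifted \<open>w i\<close> start with zero sum.\<close>
  have stationary: "(\<Sum>i\<in>UNIV. g i xstar) = 0"
  proof -
    have "((\<lambda>z. \<Sum>i\<in>UNIV. f i z) has_derivative (\<lambda>d. \<Sum>i\<in>UNIV. d \<bullet> g i xstar)) (at xstar)"
      using G unfolding gderiv_def by (intro has_derivative_sum) auto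
    then have "(\<lambda>d. \<Sum>i\<in>UNIV. d \<bullet> g i xstar) = (\<lambda>d. 0)"
      using assms(8)
      by (intro differential_zero_maxmin[of xstar UNIV]) (auto simp: is_arg_min_linorder)
    then have "d \<bullet> (\<Sum>i\<in>UNIV. g i xstar) = 0" for d
      by (metis inner_sum_right)
    then show ?thesis
      by (metis inner_eq_zero_iff)
  qed
  have fin: "finite (?S \<inter> {0..T})" for T
    using assms(5) by (simp add: piecewise_constant_def)
  have cont_x: "continuous_on {0..} (x i)" and cont_v: "continuous_on {0..} (v i)" for i
    using assms(16) by (auto simp: solution_def)
  have cont_y: "continuous_on {0..} (y i)" and cont_w: "continuous_on {0..} (w i)" for i
    unfolding y_def w_def by (intro continuous_intros cont_x cont_v)+
  have dw: "(w i has_vector_derivative (\<alpha> * \<beta>) *\<^sub>R flow i t) (at t)"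
    and dy: "(y i has_vector_derivative - \<alpha> *\<^sub>R h i t - \<beta> *\<^sub>R flow i t - w i t) (at t)"
    if "0 < t" "t \<notin> ?S" for i t
  proof -
    have at: "at t within {0..} = at t"
      using that(1) by (intro at_within_interior) simp
    have dv: "(v i has_vector_derivative (\<alpha> * \<beta>) *\<^sub>R flow i t) (at t)"
      and dx: "(x i has_vector_derivative - \<alpha> *\<^sub>R g i (x i t) - \<beta> *\<^sub>R flow i t - v i t) (at t)"
      using assms(16) that unfolding solution_def flow_def g_def at[symmetric] by auto
    show "(w i has_vector_derivative (\<alpha> * \<beta>) *\<^sub>R flow i t) (at t)"
      unfolding w_def using dv by (auto intro!: derivative_eq_intros)
    have "- \<alpha> *\<^sub>R g i (x i t) - \<beta> *\<^sub>R flow i t - v i t = - \<alpha> *\<^sub>R h i t - \<beta> *\<^sub>R flow i t - w i t"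
      by (simp add: h_def w_def scaleR_diff_right)
    then show "(y i has_vector_derivative - \<alpha> *\<^sub>R h i t - \<beta> *\<^sub>R flow i t - w i t) (at t)"
      unfolding y_def using dx by (auto intro!: derivative_eq_intros)
  qed
  have graph: "is_adjacency (A t)" "strongly_connected (A t)" "weight_balanced (A t)"
      "lam2min \<le> lambda2_hat (laplacian (A t))" if "0 \<le> t" for t
    using assms(2,3,10) that by metis+
  have sum_w: "(\<Sum>i\<in>UNIV. w i t) = 0" if "0 \<le> t" for t
  proof -
    have "(\<Sum>i\<in>UNIV. w i t) = (\<Sum>i\<in>UNIV. w i 0)"
    proof (rule constant_off_switching_times[of ?S "\<lambda>t. \<Sum>i\<in>UNIV. w i t"])
      fix s :: real assume s: "0 < s" "s \<notin> ?S"
      have "((\<lambda>t. \<Sum>i\<in>UNIV. w i t) has_vector_derivative (\<Sum>i\<in>UNIV. (\<alpha> * \<beta>) *\<^sub>R flow i s)) (at s)"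
        using dw[OF s] by (intro has_vector_derivative_sum) auto
      moreover have "(\<Sum>i\<in>UNIV. flow i s) = 0"
        unfolding flow_def using graph(3)[of s] s(1) by (intro balanced_flow_sum) simp
      ultimately show "((\<lambda>t. \<Sum>i\<in>UNIV. w i t) has_vector_derivative 0) (at s)"
        by (simp flip: scaleR_sum_right)
    qed (use fin that cont_w in \<open>auto intro!: continuous_intros\<close>)
    also have "\<dots> = 0"
      using assms(17) stationary by (simp add: w_def sum.distrib flip: scaleR_sum_right)
    finally show ?thesis .
  qed
  define Y where "Y t = (\<Sum>i\<in>UNIV. (norm (y i t))\<^sup>2)" for t
  define W where "W t = (\<Sum>i\<in>UNIV. (norm (w i t))\<^sup>2)" for t
  \<comment> \<open>Inner products instead of squared norms let the product rule for bilinear maps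
    differentiate \<open>V\<close>.\<close>
  define V where "V t = (\<Sum>i\<in>UNIV. \<phi> * \<alpha>\<^sup>2 / 2 * (y i t \<bullet> y i t)
      + 1 / 2 * ((\<alpha> *\<^sub>R y i t + w i t) \<bullet> (\<alpha> *\<^sub>R y i t + w i t)))" for t
  \<comment> \<open>Normalized so that the derivative of \<open>V\<close> is
    \<open>- \<alpha> * D t\<close>.\<close>
  define D where "D t = (\<phi> + 1) * \<alpha>\<^sup>2 * (\<Sum>i\<in>UNIV. y i t \<bullet> h i t)
      + \<phi> * \<alpha> * \<beta> * (\<Sum>i\<in>UNIV. y i t \<bullet> flow i t)
      + (\<phi> + 1) * \<alpha> * (\<Sum>i\<in>UNIV. y i t \<bullet> w i t) + \<alpha> * (\<Sum>i\<in>UNIV. w i t \<bullet> h i t) + W t" for t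
  define c1 where "c1 = 8 / 9 * (\<phi> + 1 - 4 * MM) * mm * \<alpha>\<^sup>2"
  define c2 where "c2 = (\<phi> / 2 + 1) * \<alpha>\<^sup>2"
  \<comment> \<open>The two bounds ensure
    \<open>r * (c2 * Y t + W t) \<le> c1 * Y t + 3 / 8 * W t\<close>, which compares the upper bound
    of \<open>V\<close> with the dissipation term by term.\<close>
  define r where "r = min (c1 / c2) (3 / 8)"
  have "0 < c1" "0 < c2"
    using pos phi \<open>0 < mm\<close> by (auto simp: c1_def c2_def intro!: mult_pos_pos add_pos_pos)
  then have "0 < r"
    by (simp add: r_def)
  have r_le: "r \<le> 3 / 8"
    unfolding r_def by (rule min.cobounded2)
  have dissipation: "c1 * Y t + 3 / 8 * W t \<le> D t" if "0 \<le> t" for t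
  proof -
    define c where "c = (1 / real CARD('n)) *\<^sub>R (\<Sum>i\<in>UNIV. y i t)"
    have c: "(\<Sum>i\<in>UNIV. y i t - c) = 0"
      by (simp add: sum_subtractf c_def sum_constant_scaleR del: sum_constant)
    have "flow i t = (\<Sum>j\<in>UNIV. A t $ i $ j *\<^sub>R (y i t - y j t))" for i
      by (simp add: flow_def y_def)
    then have "lambda2_hat (laplacian (A t)) * (\<Sum>i\<in>UNIV. (norm (y i t - c))\<^sup>2)
        \<le> (\<Sum>i\<in>UNIV. y i t \<bullet> flow i t)"
      using lambda2_hat_dirichlet_bound[OF graph(1-3)[OF that] assms(1) c] by simp
    \<comment> \<open>Passing from the gap of the current graph to the uniform one makes the decay
      rate the same for all realizations.\<close>
    moreover have "lam2min * (\<Sum>i\<in>UNIV. (norm (y i t - c))\<^sup>2)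
        \<le> lambda2_hat (laplacian (A t)) * (\<Sum>i\<in>UNIV. (norm (y i t - c))\<^sup>2)"
      using graph(4)[OF that] by (intro mult_right_mono sum_nonneg) auto
    ultimately have Q: "lam2min * (\<Sum>i\<in>UNIV. (norm (y i t - c))\<^sup>2) \<le> (\<Sum>i\<in>UNIV. y i t \<bullet> flow i t)"
      by linarith
    show ?thesis
      unfolding Y_def W_def D_def c1_def
      by (rule lyapunov_dissipation[OF pos \<open>0 < mm\<close> sum_w[OF that] c strong coco Q phi])
        (use assms(15) in \<open>simp add: mm_def MM_def\<close>)
  qed
  have V_split: "V t = \<phi> * \<alpha>\<^sup>2 / 2 * Y t + 1 / 2 * (\<Sum>i\<in>UNIV. (norm (\<alpha> *\<^sub>R y i t + w i t))\<^sup>2)" for t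
    by (simp add: V_def Y_def power2_norm_eq_inner sum.distrib sum_distrib_left)
  have V_le: "V t \<le> c2 * Y t + W t" for t
  proof -
    have "(norm (\<alpha> *\<^sub>R y i t + w i t))\<^sup>2 \<le> 2 * \<alpha>\<^sup>2 * (norm (y i t))\<^sup>2 + 2 * (norm (w i t))\<^sup>2" for i
    proof -
      have "0 \<le> (\<alpha> *\<^sub>R y i t - w i t) \<bullet> (\<alpha> *\<^sub>R y i t - w i t)"
        by (rule inner_ge_zero)
      then show ?thesis
        unfolding power2_norm_eq_inner
        by (simp add: inner_add_left inner_add_right inner_diff_left
            inner_diff_right power2_eq_square inner_commute algebra_simps)
    qed
    then have "(\<Sum>i\<in>UNIV. (norm (\<alpha> *\<^sub>R y i t + w i t))\<^sup>2)
        \<le> (\<Sum>i\<in>UNIV. 2 * \<alpha>\<^sup>2 * (norm (y i t))\<^sup>2 + 2 * (norm (w i t))\<^sup>2)"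
      by (intro sum_mono)
    also have "\<dots> = 2 * \<alpha>\<^sup>2 * Y t + 2 * W t"
      by (simp add: Y_def W_def sum.distrib sum_distrib_left)
    finally show ?thesis
      by (simp add: V_split c2_def algebra_simps)
  qed
  have V_deriv: "(V has_vector_derivative - \<alpha> * D t) (at t)" if t: "0 < t" "t \<notin> ?S" for t
  proof -
    note dinner = bounded_bilinear.has_vector_derivative[OF bounded_bilinear_inner]
    define dyi where "dyi i = - \<alpha> *\<^sub>R h i t - \<beta> *\<^sub>R flow i t - w i t" for i
    define dui where "dui i = - \<alpha>\<^sup>2 *\<^sub>R h i t - \<alpha> *\<^sub>R w i t" for i
    have dy': "(y i has_vector_derivative dyi i) (at t)" for i
      unfolding dyi_def by (rule dy[OF t])
    have du: "((\<lambda>t. \<alpha> *\<^sub>R y i t + w i t) has_vector_derivative dui i) (at t)" for i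
    proof -
      have "((\<lambda>t. \<alpha> *\<^sub>R y i t + w i t) has_vector_derivative \<alpha> *\<^sub>R dyi i + (\<alpha> * \<beta>) *\<^sub>R flow i t) (at t)"
        using dy'[of i] dw[OF t, of i] by (auto intro!: derivative_eq_intros)
      moreover have "\<alpha> *\<^sub>R dyi i + (\<alpha> * \<beta>) *\<^sub>R flow i t = dui i"
        by (simp add: dyi_def dui_def algebra_simps power2_eq_square)
      ultimately show ?thesis
        by simp
    qed
    have summand: "((\<lambda>t. \<phi> * \<alpha>\<^sup>2 / 2 * (y i t \<bullet> y i t)
          + 1 / 2 * ((\<alpha> *\<^sub>R y i t + w i t) \<bullet> (\<alpha> *\<^sub>R y i t + w i t)))
        has_vector_derivative \<phi> * \<alpha>\<^sup>2 * (y i t \<bullet> dyi i) + (\<alpha> *\<^sub>R y i t + w i t) \<bullet> dui i) (at t)" for i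
    proof -
      have "((\<lambda>t. \<phi> * \<alpha>\<^sup>2 / 2 * (y i t \<bullet> y i t)
          + 1 / 2 * ((\<alpha> *\<^sub>R y i t + w i t) \<bullet> (\<alpha> *\<^sub>R y i t + w i t)))
        has_vector_derivative \<phi> * \<alpha>\<^sup>2 / 2 * (y i t \<bullet> dyi i + dyi i \<bullet> y i t)
          + 1 / 2 * ((\<alpha> *\<^sub>R y i t + w i t) \<bullet> dui i + dui i \<bullet> (\<alpha> *\<^sub>R y i t + w i t))) (at t)"
        by (intro has_vector_derivative_add has_vector_derivative_mult_right dinner dy' du)
      then show ?thesis
        by (simp add: inner_commute[of "dyi i"] inner_commute[of "dui i"] mult.assoc)
    qed
    have "(V has_vector_derivative
        (\<Sum>i\<in>UNIV. \<phi> * \<alpha>\<^sup>2 * (y i t \<bullet> dyi i) + (\<alpha> *\<^sub>R y i t + w i t) \<bullet> dui i)) (at t)"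
      unfolding V_def by (intro has_vector_derivative_sum summand)
    moreover have "(\<Sum>i\<in>UNIV. \<phi> * \<alpha>\<^sup>2 * (y i t \<bullet> dyi i) + (\<alpha> *\<^sub>R y i t + w i t) \<bullet> dui i) = - \<alpha> * D t"
    proof -
      \<comment> \<open>The factors \<phi> + 1 collect \<phi> from the first part of
        \<open>V\<close> and 1 from the second; the Laplacian term carries only \<phi>, as it is
        absent from \<open>dui\<close>.\<close>
      have "\<phi> * \<alpha>\<^sup>2 * (y i t \<bullet> dyi i) + (\<alpha> *\<^sub>R y i t + w i t) \<bullet> dui i
          = - \<alpha> * ((\<phi> + 1) * \<alpha>\<^sup>2 * (y i t \<bullet> h i t) + \<phi> * \<alpha> * \<beta> * (y i t \<bullet> flow i t)
            + (\<phi> + 1) * \<alpha> * (y i t \<bullet> w i t) + \<alpha> * (w i t \<bullet> h i t) + (norm (w i t))\<^sup>2)" for i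
        unfolding dyi_def dui_def power2_norm_eq_inner
        by (simp add: inner_add_left inner_diff_right power2_eq_square algebra_simps)
      then have "(\<Sum>i\<in>UNIV. \<phi> * \<alpha>\<^sup>2 * (y i t \<bullet> dyi i) + (\<alpha> *\<^sub>R y i t + w i t) \<bullet> dui i)
          = - \<alpha> * (\<Sum>i\<in>UNIV. (\<phi> + 1) * \<alpha>\<^sup>2 * (y i t \<bullet> h i t) + \<phi> * \<alpha> * \<beta> * (y i t \<bullet> flow i t)
            + (\<phi> + 1) * \<alpha> * (y i t \<bullet> w i t) + \<alpha> * (w i t \<bullet> h i t) + (norm (w i t))\<^sup>2)"
        by (simp only: sum_distrib_left)
      then show ?thesis
        by (simp only: D_def W_def sum.distrib sum_distrib_left)
    qed
    ultimately show ?thesis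
      by simp
  qed
  have decay: "V t \<le> V 0 * exp (- (\<alpha> * r) * t)" if "0 \<le> t" for t
  proof (rule exponential_decay_off_switching_times[OF fin _ _ that])
    show "continuous_on {0..} V"
      unfolding V_def by (intro continuous_intros cont_y cont_w)
    fix s :: real assume s: "0 < s" "s \<notin> ?S"
    have "r * V s \<le> r * (c2 * Y s + W s)"
      using V_le \<open>0 < r\<close> by (intro mult_left_mono) auto
    also have "\<dots> = r * c2 * Y s + r * W s"
      by (simp add: algebra_simps)
    also have "\<dots> \<le> c1 * Y s + 3 / 8 * W s"
    proof (intro add_mono mult_right_mono)
      have "r * c2 \<le> c1 / c2 * c2"
        using \<open>0 < c2\<close> by (intro mult_right_mono) (auto simp: r_def)
      then show "r * c2 \<le> c1"
        using \<open>0 < c2\<close> by simp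
    qed (use r_le in \<open>auto simp: Y_def W_def intro: sum_nonneg\<close>)
    also have "\<dots> \<le> D s"
      using dissipation s by simp
    finally have "- \<alpha> * D s \<le> - (\<alpha> * r) * V s"
      using pos by simp
    then show "\<exists>E\<le>- (\<alpha> * r) * V s. (V has_vector_derivative E) (at s)"
      using V_deriv[OF s] by blast
  qed
  define a where "a = \<phi> * \<alpha>\<^sup>2 / 2"
  have "0 < a"
    using pos by (simp add: a_def)
  have V_ge: "a * (norm (y i0 t))\<^sup>2 \<le> V t" for t
  proof -
    have "(norm (y i0 t))\<^sup>2 \<le> Y t"
      unfolding Y_def by (rule member_le_sum) auto
    then have "a * (norm (y i0 t))\<^sup>2 \<le> a * Y t"
      using \<open>0 < a\<close> by (intro mult_left_mono) auto
    also have "\<dots> \<le> V t"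
      unfolding V_split a_def by (simp add: sum_nonneg)
    finally show ?thesis .
  qed
  \<comment> \<open>\<open>V\<close> controls the squared error, so taking the root halves the rate
    \<alpha> * r.\<close>
  have "norm (x i0 t - xstar) \<le> sqrt (V 0 / a) * exp (- (\<alpha> * r / 2) * t)" if "0 \<le> t" for t
  proof -
    have "(norm (y i0 t))\<^sup>2 \<le> V 0 / a * exp (- (\<alpha> * r) * t)"
      using order_trans[OF V_ge decay[OF that]] \<open>0 < a\<close> by (simp add: field_simps)
    then have "norm (y i0 t) \<le> sqrt (V 0 / a * exp (- (\<alpha> * r) * t))"
      by (rule real_le_rsqrt)
    also have "\<dots> = sqrt (V 0 / a) * exp (- (\<alpha> * r / 2) * t)"
    proof -
      have "exp (- (\<alpha> * r) * t) = (exp (- (\<alpha> * r / 2) * t))\<^sup>2"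
        by (simp flip: exp_double)
      then show ?thesis
        by (simp only: real_sqrt_mult real_sqrt_abs abs_exp_cancel)
    qed
    finally show ?thesis
      by (simp add: y_def)
  qed
  moreover have "0 \<le> V 0"
    using V_ge[of 0] \<open>0 < a\<close> by (meson less_imp_le mult_nonneg_nonneg order_trans zero_le_power2)
  ultimately show "converges_exponentially (x i0) xstar"
    unfolding converges_exponentially_def using \<open>0 < a\<close> \<open>0 < r\<close> pos
    by (intro exI[of _ "sqrt (V 0 / a)"] exI[of _ "\<alpha> * r / 2"] conjI) auto
qed

end
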